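(* Let $S$ be a left simple semigroup. If $S$ has a composition series, then every two composition series of $S$ are isomorphic with each other.
   Context: A semigroup $S$ is left simple if for all $a,b\in S$ there is $s\in S$ with $sa=b$. Subsemigroups are non-empty. A subset $H$ of a semigroup $S$ is reflexive in $S$ if $ab\in H$ implies $ba\in H$ for all $a,b\in S$. A subset $U$ of $S$ is left [right] unitary in $S$ if $ab,a\in U$ implies $b\in U$ [$ab,b\in U$ implies $a\in U$] for all $a,b\in S$; it is unitary in $S$ if it is both left and right unitary in $S$. A reflexive unitary subsemigroup of $S$ is a subsemigroup that is reflexive and unitary in $S$. For a non-empty subset $H$ of a semigroup $T$, the principal congruence on $T$ determined by $H$ is $P_H(T)=\{(a,b)\in T\times T:\ \text{for all } s,t\in T,\ sat\in H \iff sbt\in H\}$; it is a congruence on $T$. One writes $T/P_H$ for the factor semigroup $T/P_H(T)$. If $T$ is left simple and $H$ is a reflexive unitary subsemigroup of $T$, then $T/P_H$ is a group with identity element $H$. A normal series of a left simple semigroup $S$ is a finite sequence $S=S_0\supseteq S_1\supseteq\dots\supseteq S_k$ of subsemigroups of $S$ such that $S_i$ is a reflexive unitary subsemigroup of $S_{i-1}$ for $i=1,\dots,k$. The integer $k$ is its length; its factors are the groups $S_{i-1}/P_{S_i}$ ($=S_{i-1}/P_{S_i}(S_{i-1})$), $i=1,\dots,k$. Two normal series $S=S_0\supseteq\dots\supseteq S_k$ and $S=H_0\supseteq\dots\supseteq H_n$ are isomorphic if $n=k$ and there is a permutation $i\mapsto i^*$ of $\{1,\dots,k\}$ such that $S_{i-1}/P_{S_i}$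 and $H_{i^*-1}/P_{H_{i^*}}$ are isomorphic for $i=1,\dots,k$. A normal series $S=S_0\supseteq S_1\supseteq\dots\supseteq S_k$ is a composition series of $S$ if, putting $S_{k+1}=\emptyset$, for every $i=1,\dots,k+1$ one has $S_{i-1}\ne S_i$ and $S_{i-1}$ has no reflexive unitary subsemigroup $T$ with $S_{i-1}\supset T\supset S_i$ (strict inclusions). *)

theory Defs
  imports "HOL-Algebra.Group" "HOL-Combinatorics.Permutations"
begin

definition subsemigroup_of :: "'a::semigroup_mult set \<Rightarrow> 'a set \<Rightarrow> bool" where
  "subsemigroup_of H S \<longleftrightarrow> H \<noteq> {} \<and> H \<subseteq> S \<and> (\<forall>a\<in>H. \<forall>b\<in>H. a * b \<in> H)"

text \<open>
  A semigroup is a non-empty multiplicatively closed subset \<open>S\<close> of a type of class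
  \<^class>\<open>semigroup_mult\<close>; \<open>S = UNIV\<close> is allowed, so every semigroup is covered.
\<close>

definition left_simple_semigroup :: "'a::semigroup_mult set \<Rightarrow> bool" where
  "left_simple_semigroup S \<longleftrightarrow>
     subsemigroup_of S S \<and> (\<forall>a\<in>S. \<forall>b\<in>S. \<exists>s\<in>S. s * a = b)"

definition reflexive_in :: "'a::semigroup_mult set \<Rightarrow> 'a set \<Rightarrow> bool" where
  "reflexive_in H S \<longleftrightarrow> (\<forall>a\<in>S. \<forall>b\<in>S. a * b \<in> H \<longrightarrow> b * a \<in> H)"

definition left_unitary_in :: "'a::semigroup_mult set \<Rightarrow> 'a set \<Rightarrow> bool" where
  "left_unitary_in U S \<longleftrightarrow> (\<forall>a\<in>S. \<forall>b\<in>S. a * b \<in> U \<and> a \<in> U \<longrightarrow> b \<in> U)"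

definition right_unitary_in :: "'a::semigroup_mult set \<Rightarrow> 'a set \<Rightarrow> bool" where
  "right_unitary_in U S \<longleftrightarrow> (\<forall>a\<in>S. \<forall>b\<in>S. a * b \<in> U \<and> b \<in> U \<longrightarrow> a \<in> U)"

definition unitary_in :: "'a::semigroup_mult set \<Rightarrow> 'a set \<Rightarrow> bool" where
  "unitary_in U S \<longleftrightarrow> left_unitary_in U S \<and> right_unitary_in U S"

definition reflexive_unitary_subsemigroup :: "'a::semigroup_mult set \<Rightarrow> 'a set \<Rightarrow> bool" where
  "reflexive_unitary_subsemigroup H S \<longleftrightarrow>
     subsemigroup_of H S \<and> reflexive_in H S \<and> unitary_in H S"

definition principal_congruence :: "'a::semigroup_mult set \<Rightarrow> 'a set \<Rightarrow> ('a \<times> 'a) set" where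
  "principal_congruence H T =
     {(a, b). a \<in> T \<and> b \<in> T \<and> (\<forall>s\<in>T. \<forall>t\<in>T. s * a * t \<in> H \<longleftrightarrow> s * b * t \<in> H)}"

text \<open>
  The product of two classes is the class of the product of representatives, see
  \<open>factor_semigroup_mult\<close> below. The unit \<open>H\<close> is meaningful only under the hypotheses of
  \<open>factor_semigroup_group\<close>; \<open>\<cong>\<close> does not refer to it.
\<close>

definition factor_semigroup :: "'a::semigroup_mult set \<Rightarrow> 'a set \<Rightarrow> 'a set monoid" where
  "factor_semigroup T H =
     \<lparr>carrier = T // principal_congruence H T,
      monoid.mult = (\<lambda>A B. \<Union>a\<in>A. \<Union>b\<in>B. principal_congruence H T `` {a * b}),
      one = H\<rparr>"

text \<open>A sequence of length \<open>k\<close> is a function on \<open>nat\<close>, of which only the values at \<open>0, \<dots>, k\<close>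
  are relevant.\<close>

definition normal_series :: "'a::semigroup_mult set \<Rightarrow> nat \<Rightarrow> (nat \<Rightarrow> 'a set) \<Rightarrow> bool" where
  "normal_series S k A \<longleftrightarrow>
     A 0 = S \<and>
     (\<forall>i\<le>k. subsemigroup_of (A i) S) \<and>
     (\<forall>i\<in>{1..k}. A i \<subseteq> A (i - 1) \<and> reflexive_unitary_subsemigroup (A i) (A (i - 1)))"

definition isomorphic_series ::
  "nat \<Rightarrow> (nat \<Rightarrow> 'a::semigroup_mult set) \<Rightarrow> nat \<Rightarrow> (nat \<Rightarrow> 'a set) \<Rightarrow> bool" where
  "isomorphic_series k A n B \<longleftrightarrow>
     n = k \<and>
     (\<exists>p. p permutes {1..k} \<and>
        (\<forall>i\<in>{1..k}. factor_semigroup (A (i - 1)) (A i) \<cong>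
                      factor_semigroup (B (p i - 1)) (B (p i))))"

definition composition_series :: "'a::semigroup_mult set \<Rightarrow> nat \<Rightarrow> (nat \<Rightarrow> 'a set) \<Rightarrow> bool" where
  "composition_series S k A \<longleftrightarrow>
     normal_series S k A \<and>
     (let A' = A(k + 1 := {}) in
        \<forall>i\<in>{1..k + 1}.
          A' (i - 1) \<noteq> A' i \<and>
          \<not> (\<exists>T. reflexive_unitary_subsemigroup T (A' (i - 1)) \<and>
                 A' i \<subset> T \<and> T \<subset> A' (i - 1)))"

lemma equiv_principal_congruence: "equiv T (principal_congruence H T)"
  by (rule equivI) (auto simp: principal_congruence_def refl_on_def sym_def trans_def)

lemma principal_congruence_mult:
  assumes "subsemigroup_of T T"
    and "(a, b) \<in> principal_congruence H T" "(c, d) \<in> principal_congruence H T"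
  shows "(a * c, b * d) \<in> principal_congruence H T"
proof -
  have T: "\<And>x y. x \<in> T \<Longrightarrow> y \<in> T \<Longrightarrow> x * y \<in> T"
    using assms(1) by (simp add: subsemigroup_of_def)
  have m: "a \<in> T" "b \<in> T" "c \<in> T" "d \<in> T"
    using assms(2,3) by (auto simp: principal_congruence_def)
  have ab: "s * a * t \<in> H \<longleftrightarrow> s * b * t \<in> H" if "s \<in> T" "t \<in> T" for s t
    using assms(2) that by (auto simp: principal_congruence_def)
  have cd: "s * c * t \<in> H \<longleftrightarrow> s * d * t \<in> H" if "s \<in> T" "t \<in> T" for s t
    using assms(3) that by (auto simp: principal_congruence_def)
  have "s * (a * c) * t \<in> H \<longleftrightarrow> s * (b * d) * t \<in> H" if "s \<in> T" "t \<in> T" for s t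
    using ab[of s "c * t"] cd[of "s * b" t] that m T by (simp add: mult.assoc)
  then show ?thesis
    using m T by (auto simp: principal_congruence_def)
qed

lemma factor_semigroup_mult:
  assumes "subsemigroup_of T T" "a \<in> T" "b \<in> T"
  shows "(principal_congruence H T `` {a}) \<otimes>\<^bsub>factor_semigroup T H\<^esub>
           (principal_congruence H T `` {b}) = principal_congruence H T `` {a * b}"
proof -
  let ?P = "principal_congruence H T"
  note eq = equiv_principal_congruence[of T H]
  have "?P `` {x * y} = ?P `` {a * b}" if "x \<in> ?P `` {a}" "y \<in> ?P `` {b}" for x y
    using principal_congruence_mult[OF assms(1), of a x H b y] that equiv_class_eq[OF eq] by auto
  moreover have "a \<in> ?P `` {a}" "b \<in> ?P `` {b}"
    using equiv_class_self[OF eq] assms by auto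
  ultimately have "(\<Union>x\<in>?P `` {a}. \<Union>y\<in>?P `` {b}. ?P `` {x * y}) = ?P `` {a * b}"
    by blast
  then show ?thesis
    by (simp add: factor_semigroup_def)
qed

lemma principal_congruence_class_eq:
  assumes "subsemigroup_of T T" "reflexive_unitary_subsemigroup H T" "h \<in> H"
  shows "principal_congruence H T `` {h} = H"
proof -
  have T: "\<And>x y. x \<in> T \<Longrightarrow> y \<in> T \<Longrightarrow> x * y \<in> T"
    using assms(1) by (simp add: subsemigroup_of_def)
  have HT: "\<And>x. x \<in> H \<Longrightarrow> x \<in> T" and HH: "\<And>x y. x \<in> H \<Longrightarrow> y \<in> H \<Longrightarrow> x * y \<in> H"
    and R: "\<And>x y. x \<in> T \<Longrightarrow> y \<in> T \<Longrightarrow> x * y \<in> H \<Longrightarrow> y * x \<in> H"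
    and L: "\<And>x y. x \<in> H \<Longrightarrow> y \<in> T \<Longrightarrow> x * y \<in> H \<Longrightarrow> y \<in> H"
    using assms(2) unfolding reflexive_unitary_subsemigroup_def subsemigroup_of_def
      reflexive_in_def unitary_in_def left_unitary_in_def by blast+
  have imp: "s * b * t \<in> H" if "a \<in> H" "b \<in> H" "s \<in> T" "t \<in> T" "s * a * t \<in> H" for a b s t
  proof -
    have "a * (t * s) \<in> H"
      using R[of s "a * t"] that T HT by (simp add: mult.assoc)
    then have "b * (t * s) \<in> H"
      using L HH that T by blast
    then show ?thesis
      using R[of "b * t" s] that T HT by (simp add: mult.assoc)
  qed
  have "b \<in> H" if "(h, b) \<in> principal_congruence H T" for b
  proof -
    have "h * h * h \<in> H"
      using assms(3) HH by simp
    then have b: "b \<in> T" "h * b * h \<in> H"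
      using that HT[OF assms(3)] unfolding principal_congruence_def by auto
    then have "b * h \<in> H"
      using L[of h "b * h"] assms(3) T HT by (simp add: mult.assoc)
    then show ?thesis
      using R[of b h] L[of h b] b(1) assms(3) HT by simp
  qed
  moreover have "(h, b) \<in> principal_congruence H T" if "b \<in> H" for b
    using imp[of h b] imp[of b h] that assms(3) HT by (auto simp: principal_congruence_def)
  ultimately show ?thesis by blast
qed

lemma factor_semigroup_group:
  assumes "left_simple_semigroup T" "reflexive_unitary_subsemigroup H T"
  shows "group (factor_semigroup T H)"
proof -
  let ?P = "principal_congruence H T" and ?G = "factor_semigroup T H"
  have TT: "subsemigroup_of T T" and ls: "\<And>a b. a \<in> T \<Longrightarrow> b \<in> T \<Longrightarrow> \<exists>s\<in>T. s * a = b"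
    using assms(1) by (auto simp: left_simple_semigroup_def)
  have T: "\<And>x y. x \<in> T \<Longrightarrow> y \<in> T \<Longrightarrow> x * y \<in> T"
    using TT by (simp add: subsemigroup_of_def)
  have HT: "\<And>x. x \<in> H \<Longrightarrow> x \<in> T" and HH: "\<And>x y. x \<in> H \<Longrightarrow> y \<in> H \<Longrightarrow> x * y \<in> H"
    and R: "\<And>x y. x \<in> T \<Longrightarrow> y \<in> T \<Longrightarrow> x * y \<in> H \<Longrightarrow> y * x \<in> H"
    and L: "\<And>x y. x \<in> H \<Longrightarrow> y \<in> T \<Longrightarrow> x * y \<in> H \<Longrightarrow> y \<in> H" and "H \<noteq> {}"
    using assms(2) unfolding reflexive_unitary_subsemigroup_def subsemigroup_of_def
      reflexive_in_def unitary_in_def left_unitary_in_def by blast+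
  then obtain h where h: "h \<in> H" by blast
  have cls: "?P `` {h} = H"
    by (rule principal_congruence_class_eq[OF TT assms(2) h])
  have car: "carrier ?G = (\<lambda>a. ?P `` {a}) ` T" and one: "\<one>\<^bsub>?G\<^esub> = ?P `` {h}"
    using cls by (auto simp: factor_semigroup_def quotient_def)
  note m = factor_semigroup_mult[OF TT, of _ _ H]
  have unit: "?P `` {h * a} = ?P `` {a}" if a: "a \<in> T" for a
  proof -
    have "s * (h * a) * t \<in> H \<longleftrightarrow> s * a * t \<in> H" if s: "s \<in> T" "t \<in> T" for s t
    proof -
      have "s * (h * a) * t \<in> H \<longleftrightarrow> h * (a * t * s) \<in> H"
        using R[of s "h * a * t"] R[of "h * a * t" s] a s h T HT by (auto simp: mult.assoc)
      also have "\<dots> \<longleftrightarrow> a * t * s \<in> H"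
        using L[of h "a * t * s"] HH h a s T by blast
      also have "\<dots> \<longleftrightarrow> s * a * t \<in> H"
        using R[of s "a * t"] R[of "a * t" s] a s T by (auto simp: mult.assoc)
      finally show ?thesis .
    qed
    then have "(h * a, a) \<in> ?P"
      using a h T HT by (simp add: principal_congruence_def)
    then show ?thesis
      using equiv_class_eq[OF equiv_principal_congruence] by metis
  qed
  show ?thesis
  proof (rule groupI)
    show "x \<otimes>\<^bsub>?G\<^esub> y \<in> carrier ?G" if "x \<in> carrier ?G" "y \<in> carrier ?G" for x y
      using that m T unfolding car by auto
    show "\<one>\<^bsub>?G\<^esub> \<in> carrier ?G"
      unfolding car one using h HT by blast
    show "x \<otimes>\<^bsub>?G\<^esub> y \<otimes>\<^bsub>?G\<^esub> z = x \<otimes>\<^bsub>?G\<^esub> (y \<otimes>\<^bsub>?G\<^esub> z)"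
      if "x \<in> carrier ?G" "y \<in> carrier ?G" "z \<in> carrier ?G" for x y z
      using that m T unfolding car by (auto simp: mult.assoc)
    show "\<one>\<^bsub>?G\<^esub> \<otimes>\<^bsub>?G\<^esub> x = x" if "x \<in> carrier ?G" for x
      using that m unit h HT unfolding car one by auto
    show "\<exists>y\<in>carrier ?G. y \<otimes>\<^bsub>?G\<^esub> x = \<one>\<^bsub>?G\<^esub>" if "x \<in> carrier ?G" for x
    proof -
      obtain a where a: "a \<in> T" "x = ?P `` {a}"
        using \<open>x \<in> carrier ?G\<close> unfolding car by (elim imageE)
      obtain s where "s \<in> T" "s * a = h"
        using ls[OF a(1) HT[OF h]] by blast
      then show ?thesis
        using m[of s a] a unfolding car one by auto
    qed
  qed
qed

end

theory Submission
  imports Defs "HOL-Algebra.Coset"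
begin

text \<open>
  Reflexive unitary subsemigroups of a left simple semigroup behave like normal subgroups: they
  are left simple, they are the kernels of the homomorphisms onto groups, and a homomorphism onto
  a group maps them to normal subgroups. Any two of them intersect, because an element \<open>e\<close> with
  \<open>e * a = a\<close> for some \<open>a\<close> lies in all of them. Hence two distinct maximal ones \<open>H\<close> and \<open>K\<close>
  satisfy \<open>H/(H \<inter> K) \<cong> S/K\<close>, with \<open>H \<inter> K\<close> maximal in \<open>H\<close>, and the usual exchange
  argument for the Jordan-Hoelder theorem applies.
\<close>

section \<open>Reflexive unitary subsemigroups of left simple semigroups\<close>

lemma reflexive_unitary_subsemigroupD:
  assumes "reflexive_unitary_subsemigroup H S"
  shows "H \<noteq> {}" "H \<subseteq> S"
    and "\<And>x y. x \<in> H \<Longrightarrow> y \<in> H \<Longrightarrow> x * y \<in> H"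
    and "\<And>x y. x \<in> S \<Longrightarrow> y \<in> S \<Longrightarrow> x * y \<in> H \<Longrightarrow> y * x \<in> H"
    and "\<And>x y. x \<in> H \<Longrightarrow> y \<in> S \<Longrightarrow> x * y \<in> H \<Longrightarrow> y \<in> H"
    and "\<And>x y. x \<in> S \<Longrightarrow> y \<in> H \<Longrightarrow> x * y \<in> H \<Longrightarrow> x \<in> H"
  using assms unfolding reflexive_unitary_subsemigroup_def subsemigroup_of_def
    reflexive_in_def unitary_in_def left_unitary_in_def right_unitary_in_def
  by blast+

lemma reflexive_unitary_subsemigroupI:
  assumes "H \<noteq> {}" "H \<subseteq> S"
    and "\<And>x y. x \<in> H \<Longrightarrow> y \<in> H \<Longrightarrow> x * y \<in> H"
    and "\<And>x y. x \<in> S \<Longrightarrow> y \<in> S \<Longrightarrow> x * y \<in> H \<Longrightarrow> y * x \<in> H"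
    and "\<And>x y. x \<in> H \<Longrightarrow> y \<in> S \<Longrightarrow> x * y \<in> H \<Longrightarrow> y \<in> H"
    and "\<And>x y. x \<in> S \<Longrightarrow> y \<in> H \<Longrightarrow> x * y \<in> H \<Longrightarrow> x \<in> H"
  shows "reflexive_unitary_subsemigroup H S"
proof -
  have "subsemigroup_of H S" using assms(1-3) by (simp add: subsemigroup_of_def)
  moreover have "reflexive_in H S" using assms(4) by (simp add: reflexive_in_def)
  moreover have "left_unitary_in H S" using assms(5) unfolding left_unitary_in_def by blast
  moreover have "right_unitary_in H S" using assms(6) unfolding right_unitary_in_def by blast
  ultimately show ?thesis by (simp add: reflexive_unitary_subsemigroup_def unitary_in_def)
qed

lemma left_simple_semigroupD:
  assumes "left_simple_semigroup S"
  shows "subsemigroup_of S S" "S \<noteq> {}"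
    and "\<And>x y. x \<in> S \<Longrightarrow> y \<in> S \<Longrightarrow> x * y \<in> S"
    and "\<And>a b. a \<in> S \<Longrightarrow> b \<in> S \<Longrightarrow> \<exists>s\<in>S. s * a = b"
  using assms unfolding left_simple_semigroup_def subsemigroup_of_def by blast+

text \<open>Left simplicity of \<open>S\<close> solves \<open>s * a = b\<close>, and right unitarity
  puts the solution \<open>s\<close> into \<open>H\<close>.\<close>

lemma left_simple_reflexive_unitary_subsemigroup:
  assumes "left_simple_semigroup S" "reflexive_unitary_subsemigroup H S"
  shows "left_simple_semigroup H"
proof -
  note H = reflexive_unitary_subsemigroupD[OF assms(2)]
  have "\<exists>s\<in>H. s * a = b" if "a \<in> H" "b \<in> H" for a b
    using left_simple_semigroupD(4)[OF assms(1), of a b] that H(2,6) by blast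
  then show ?thesis
    using H(1,3) by (auto simp: left_simple_semigroup_def subsemigroup_of_def)
qed

text \<open>Write an element of \<open>H\<close> as \<open>x * a\<close>. Then
  \<open>x * e * a\<close> is the same element; reflexivity yields both \<open>a * x\<close> and
  \<open>a * x * e\<close> in \<open>H\<close>, and left unitarity leaves \<open>e\<close>. Such an
  \<open>e\<close> takes the place of an identity, which \<open>S\<close> may lack.\<close>

lemma local_unit_mem:
  assumes S: "left_simple_semigroup S" and "reflexive_unitary_subsemigroup H S"
    and a: "a \<in> S" and e: "e \<in> S" "e * a = a"
  shows "e \<in> H"
proof -
  note H = reflexive_unitary_subsemigroupD[OF assms(2)]
  note S = left_simple_semigroupD[OF assms(1)]
  obtain h where h: "h \<in> H" "h \<in> S" using H(1,2) by blast
  obtain x where x: "x \<in> S" "x * a = h" using S(4) a h by blast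
  have "(x * e) * a \<in> H" using x e h by (simp add: mult.assoc)
  then have "(a * x) * e \<in> H"
    using H(4)[of "x * e" a] x e a S(3) by (simp add: mult.assoc)
  moreover have "a * x \<in> H" using H(4)[of x a] x a h by simp
  ultimately show ?thesis using H(5) e by blast
qed

lemma left_simple_local_unit:
  assumes "left_simple_semigroup S"
  obtains a e where "a \<in> S" "e \<in> S" "e * a = a"
  using left_simple_semigroupD(2,4)[OF assms] by blast

text \<open>Non-emptiness is where left simplicity enters: a local unit of \<open>S\<close> lies in
  both \<open>H\<close> and \<open>K\<close>.\<close>

lemma reflexive_unitary_subsemigroup_Int:
  assumes "left_simple_semigroup S"
    and "reflexive_unitary_subsemigroup H S" "reflexive_unitary_subsemigroup K S"
  shows "reflexive_unitary_subsemigroup (H \<inter> K) H"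
proof -
  obtain a e where "a \<in> S" "e \<in> S" "e * a = a"
    using left_simple_local_unit[OF assms(1)] .
  then have "e \<in> H \<inter> K" using local_unit_mem assms by blast
  note H = reflexive_unitary_subsemigroupD[OF assms(2)]
    and K = reflexive_unitary_subsemigroupD[OF assms(3)]
  show ?thesis
  proof (rule reflexive_unitary_subsemigroupI)
    show "H \<inter> K \<noteq> {}" using \<open>e \<in> H \<inter> K\<close> by blast
    show "x * y \<in> H \<inter> K" if "x \<in> H \<inter> K" "y \<in> H \<inter> K" for x y
      using that H(3) K(3) by simp
    show "y * x \<in> H \<inter> K" if "x \<in> H" "y \<in> H" "x * y \<in> H \<inter> K" for x y
      using that H(2,3) K(4) by blast
    show "y \<in> H \<inter> K" if "x \<in> H \<inter> K" "y \<in> H" "x * y \<in> H \<inter> K" for x y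
      using that H(2) K(5) by blast
    show "x \<in> H \<inter> K" if "x \<in> H" "y \<in> H \<inter> K" "x * y \<in> H \<inter> K" for x y
      using that H(2) K(6) by blast
  qed simp
qed

section \<open>Homomorphisms of a left simple semigroup onto a group\<close>

text \<open>The domain is a parameter because the class map onto \<open>S/K\<close> is used twice:
  on \<open>S\<close>, and restricted to a subsemigroup \<open>H\<close> that still maps onto the
  whole group.\<close>

locale semigroup_group_hom = G: group G for G (structure) +
  fixes S :: "'a::semigroup_mult set" and f :: "'a \<Rightarrow> 'b"
  assumes left_simple: "left_simple_semigroup S"
    and surj: "f ` S = carrier G"
    and hom: "\<And>x y. x \<in> S \<Longrightarrow> y \<in> S \<Longrightarrow> f (x * y) = f x \<otimes> f y"
begin

lemmas S_closed = left_simple_semigroupD(3)[OF left_simple]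

lemma closed [simp]: "x \<in> S \<Longrightarrow> f x \<in> carrier G"
  using surj by blast

text \<open>In a group, conjugating \<open>x \<otimes> y\<close> by \<open>y\<close> gives
  \<open>y \<otimes> x\<close>, so a normal subgroup is reflexive, and cancellation makes it
  unitary. Both properties pull back along \<open>f\<close>.\<close>

lemma vimage_normal:
  assumes "N \<lhd> G"
  shows "reflexive_unitary_subsemigroup {x \<in> S. f x \<in> N} S"
    (is "reflexive_unitary_subsemigroup ?L S")
proof -
  interpret N: normal N G by (fact assms)
  obtain x where "x \<in> S" "f x = \<one>" using surj G.one_closed by (metis imageE)
  have comm: "y \<otimes> x \<in> N" if "x \<in> carrier G" "y \<in> carrier G" "x \<otimes> y \<in> N" for x y
  proof -
    have "y \<otimes> (x \<otimes> y) \<otimes> inv y \<in> N" using N.inv_op_closed2 that by blast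
    also have "y \<otimes> (x \<otimes> y) \<otimes> inv y = y \<otimes> x" using that by (simp add: G.m_assoc)
    finally show ?thesis .
  qed
  have left: "y \<in> N" if "x \<in> N" "y \<in> carrier G" "x \<otimes> y \<in> N" for x y
  proof -
    have "inv x \<otimes> (x \<otimes> y) \<in> N" using that by simp
    then show ?thesis using that by (simp add: G.m_assoc[symmetric])
  qed
  have right: "x \<in> N" if "y \<in> N" "x \<in> carrier G" "x \<otimes> y \<in> N" for x y
  proof -
    have "x \<otimes> y \<otimes> inv y \<in> N" using that by blast
    then show ?thesis using that by (simp add: G.m_assoc)
  qed
  show ?thesis
  proof (rule reflexive_unitary_subsemigroupI)
    show "x * y \<in> ?L" if "x \<in> ?L" "y \<in> ?L" for x y
      using that by (simp add: hom S_closed)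
    show "y * x \<in> ?L" if "x \<in> S" "y \<in> S" "x * y \<in> ?L" for x y
      using comm[of "f x" "f y"] that by (simp add: hom S_closed)
    show "y \<in> ?L" if "x \<in> ?L" "y \<in> S" "x * y \<in> ?L" for x y
      using left[of "f x" "f y"] that by (simp add: hom)
    show "x \<in> ?L" if "x \<in> S" "y \<in> ?L" "x * y \<in> ?L" for x y
      using right[of "f y" "f x"] that by (simp add: hom)
  qed (use \<open>x \<in> S\<close> \<open>f x = \<one>\<close> in auto)
qed

lemma local_unit_image:
  assumes "a \<in> S" "e \<in> S" "e * a = a"
  shows "f e = \<one>"
  using hom[of e a] assms by (metis G.r_cancel_one closed)

text \<open>Elements of \<open>S\<close> need not have inverses, but left simplicity gives
  \<open>s' * s = e\<close> for a local unit \<open>e\<close>, and then \<open>f s'\<close> is the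
  inverse of \<open>f s\<close>.\<close>

lemma image_normal:
  assumes "reflexive_unitary_subsemigroup H S"
  shows "f ` H \<lhd> G"
proof -
  note H = reflexive_unitary_subsemigroupD[OF assms]
  note H_ls = left_simple_reflexive_unitary_subsemigroup[OF left_simple assms]
  obtain a e where a: "a \<in> H" "e \<in> H" "e * a = a"
    using left_simple_local_unit[OF H_ls] .
  have e: "e \<in> H" "e \<in> S" "f e = \<one>"
    using a H(2) local_unit_image by blast+
  have left_inv: "inv (f s) = f s'" if "s \<in> S" "s' \<in> S" "s' * s = e" for s s'
    using that e hom[of s' s] by (intro G.inv_equality) auto
  have "subgroup (f ` H) G"
  proof
    show "f ` H \<subseteq> carrier G" using H(2) by auto
    show "\<one> \<in> f ` H" using e by force
    show "x \<otimes> y \<in> f ` H" if "x \<in> f ` H" "y \<in> f ` H" for x y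
    proof -
      from that obtain h k where hk: "h \<in> H" "k \<in> H" "x = f h" "y = f k" by blast
      then have "x \<otimes> y = f (h * k)" using H(2) by (metis hom subsetD)
      then show ?thesis using H(3) hk by blast
    qed
    show "inv x \<in> f ` H" if x: "x \<in> f ` H" for x
    proof -
      obtain h where h: "h \<in> H" "x = f h" using x by blast
      then obtain h' where "h' \<in> H" "h' * h = e"
        using left_simple_semigroupD(4)[OF H_ls] e by blast
      then show ?thesis using left_inv[of h h'] h H(2) by blast
    qed
  qed
  moreover have "g \<otimes> x \<otimes> inv g \<in> f ` H" if g: "g \<in> carrier G" and x: "x \<in> f ` H" for g x
  proof -
    obtain s h where s: "s \<in> S" "g = f s" and h: "h \<in> H" "h \<in> S" "x = f h"
      using g x H(2) surj by blast
    obtain s' where s': "s' \<in> S" "s' * s = e"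
      using left_simple_semigroupD(4)[OF left_simple] s e by blast
    \<comment> \<open>This product equals \<open>e * h\<close>. Reflexivity then moves
      \<open>s'\<close> to the right, giving a preimage of the conjugate.\<close>
    have "s' * (s * h) \<in> H" using s' H(3) e h by (simp add: mult.assoc[symmetric])
    then have "s * h * s' \<in> H" using H(4)[of s' "s * h"] s s' h S_closed by blast
    moreover have "f (s * h * s') = g \<otimes> x \<otimes> inv g"
      using s s' h left_inv by (simp add: hom S_closed)
    ultimately show ?thesis by (metis imageI)
  qed
  ultimately show ?thesis by (simp add: G.normal_inv_iff)
qed

text \<open>Choose \<open>t'\<close> in \<open>T\<close> with \<open>t' * t\<close> a local unit:
  then \<open>t' * h\<close> lies in the kernel, hence in \<open>T\<close>, and left unitarity
  cancels \<open>t'\<close>. So \<open>T\<close> is a union of fibres of \<open>f\<close>.\<close>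

lemma mem_if_image_eq:
  assumes "reflexive_unitary_subsemigroup T S" "{x \<in> S. f x = \<one>} \<subseteq> T"
    and "h \<in> S" "t \<in> T" "f h = f t"
  shows "h \<in> T"
proof -
  note T = reflexive_unitary_subsemigroupD[OF assms(1)]
  note T_ls = left_simple_reflexive_unitary_subsemigroup[OF left_simple assms(1)]
  obtain a e where a: "a \<in> T" "e \<in> T" "e * a = a"
    using left_simple_local_unit[OF T_ls] .
  obtain t' where t': "t' \<in> T" "t' * t = e"
    using left_simple_semigroupD(4)[OF T_ls] assms(4) a by blast
  have "f (t' * h) = f (t' * t)" using hom t' assms T(2) by (metis subsetD)
  also have "\<dots> = \<one>" using t' a local_unit_image T(2) by blast
  finally have "t' * h \<in> T" using assms t' T(2) S_closed by blast
  then show ?thesis using T(5) t' assms(3) by blast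
qed

lemma principal_congruence_kernel:
  "principal_congruence {x \<in> S. f x = \<one>} S = {(a, b). a \<in> S \<and> b \<in> S \<and> f a = f b}"
proof -
  have "f a = f b"
    if ab: "a \<in> S" "b \<in> S"
      and eq: "\<And>s t. s \<in> S \<Longrightarrow> t \<in> S \<Longrightarrow> f (s * a * t) = \<one> \<longleftrightarrow> f (s * b * t) = \<one>" for a b
  proof -
    \<comment> \<open>This context separates \<open>a\<close> from \<open>b\<close>:
      \<open>s * a * t\<close> lies in the kernel, and \<open>s * b * t\<close> does so only if
      \<open>f a = f b\<close>.\<close>
    obtain s t where s: "s \<in> S" "f s = inv (f a)" and t: "t \<in> S" "f t = \<one>"
      using surj ab G.inv_closed G.one_closed closed by (metis imageE)
    have "inv (f a) \<otimes> f b = \<one>"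
      using eq[OF s(1) t(1)] s t ab by (simp add: hom S_closed)
    then show ?thesis
      using ab by (metis G.inv_equality G.inv_inv G.inv_closed closed)
  qed
  then show ?thesis
    unfolding principal_congruence_def by (auto simp: S_closed hom)
qed

text \<open>First isomorphism theorem: the principal congruence of the kernel is equality under
  \<open>f\<close>, so \<open>f\<close> is constant on each class and \<open>?F\<close> reads off
  its value.\<close>

lemma factor_semigroup_kernel_iso:
  assumes "D = {x \<in> S. f x = \<one>}"
  shows "factor_semigroup S D \<cong> G"
proof -
  let ?P = "principal_congruence D S"
  let ?F = "\<lambda>X. the_elem (f ` X)"
  have P: "?P = {(a, b). a \<in> S \<and> b \<in> S \<and> f a = f b}"
    using principal_congruence_kernel assms by simp
  have F: "?F (?P `` {a}) = f a" if "a \<in> S" for a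
  proof -
    have "f ` (?P `` {a}) = {f a}" using that unfolding P by auto
    then show ?thesis by simp
  qed
  have car: "carrier (factor_semigroup S D) = (\<lambda>a. ?P `` {a}) ` S"
    by (auto simp: factor_semigroup_def quotient_def)
  have "?F \<in> Group.iso (factor_semigroup S D) G"
  proof (rule isoI)
    show "?F \<in> hom (factor_semigroup S D) G"
    proof (rule homI)
      show "?F X \<in> carrier G" if "X \<in> carrier (factor_semigroup S D)" for X
        using that F unfolding car by auto
      show "?F (X \<otimes>\<^bsub>factor_semigroup S D\<^esub> Y) = ?F X \<otimes> ?F Y"
        if "X \<in> carrier (factor_semigroup S D)" "Y \<in> carrier (factor_semigroup S D)" for X Y
      proof -
        obtain a b where ab: "a \<in> S" "b \<in> S" "X = ?P `` {a}" "Y = ?P `` {b}"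
          using \<open>X \<in> _\<close> \<open>Y \<in> _\<close> unfolding car by (elim imageE)
        then show ?thesis
          using factor_semigroup_mult[OF left_simple_semigroupD(1)[OF left_simple] ab(1,2)]
          by (simp add: F hom S_closed)
      qed
    qed
    have "inj_on ?F (carrier (factor_semigroup S D))"
      unfolding car by (rule inj_onI) (auto simp: F, auto simp: P)
    moreover have "?F ` carrier (factor_semigroup S D) = carrier G"
      unfolding car image_image using F surj by (simp cong: image_cong)
    ultimately show "bij_betw ?F (carrier (factor_semigroup S D)) (carrier G)"
      by (simp add: bij_betw_def)
  qed
  then show ?thesis by (rule is_isoI)
qed

end

section \<open>The class map onto a factor group, and pairs of maximal subsemigroups\<close>

lemma factor_semigroup_hom:
  assumes S: "left_simple_semigroup S" and K: "reflexive_unitary_subsemigroup K S"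
  shows "semigroup_group_hom (factor_semigroup S K) S (\<lambda>a. principal_congruence K S `` {a})"
proof -
  interpret group "factor_semigroup S K"
    by (rule factor_semigroup_group[OF S K])
  show ?thesis
    by unfold_locales
      (use S factor_semigroup_mult[OF left_simple_semigroupD(1)[OF S]] in
        \<open>auto simp: factor_semigroup_def quotient_def\<close>)
qed

text \<open>\<open>K\<close> is itself a congruence class and the unit of the factor, so the class
  map has kernel \<open>K\<close>.\<close>

lemma principal_congruence_class_eq_one_iff:
  assumes S: "left_simple_semigroup S" and K: "reflexive_unitary_subsemigroup K S"
    and a: "a \<in> S"
  shows "principal_congruence K S `` {a} = \<one>\<^bsub>factor_semigroup S K\<^esub> \<longleftrightarrow> a \<in> K"
  using principal_congruence_class_eq[OF left_simple_semigroupD(1)[OF S] K]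
    equiv_class_self[OF equiv_principal_congruence a, of K]
  by (auto simp: factor_semigroup_def)

definition maximal_rus :: "'a::semigroup_mult set \<Rightarrow> 'a set \<Rightarrow> bool" where
  "maximal_rus H S \<longleftrightarrow> reflexive_unitary_subsemigroup H S \<and> H \<noteq> S \<and>
     (\<forall>T. reflexive_unitary_subsemigroup T S \<longrightarrow> H \<subset> T \<longrightarrow> T = S)"

text \<open>Maximality of \<open>K\<close> makes \<open>S/K\<close> simple. The image of
  \<open>H\<close> in it is normal and nontrivial, hence everything, and the class map restricted to
  \<open>H\<close> has kernel \<open>H \<inter> K\<close>. A larger \<open>T\<close> in
  \<open>H\<close> also maps onto \<open>S/K\<close> and, containing the kernel, must be
  \<open>H\<close>.\<close>

lemma maximal_rus_Int:
  assumes S: "left_simple_semigroup S"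
    and mH: "maximal_rus H S" and mK: "maximal_rus K S" and "H \<noteq> K"
  shows "maximal_rus (H \<inter> K) H"
    and "factor_semigroup H (H \<inter> K) \<cong> factor_semigroup S K"
proof -
  have H: "reflexive_unitary_subsemigroup H S" and K: "reflexive_unitary_subsemigroup K S"
    using mH mK by (auto simp: maximal_rus_def)
  note HS = reflexive_unitary_subsemigroupD(2)[OF H]
  note H_ls = left_simple_reflexive_unitary_subsemigroup[OF S H]
  let ?G = "factor_semigroup S K" and ?f = "\<lambda>a. principal_congruence K S `` {a}"
  interpret f: semigroup_group_hom ?G S ?f by (rule factor_semigroup_hom[OF S K])
  have ker: "?f a = \<one>\<^bsub>?G\<^esub> \<longleftrightarrow> a \<in> K" if "a \<in> S" for a
    by (rule principal_congruence_class_eq_one_iff[OF S K that])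
  \<comment> \<open>Simplicity of \<open>S/K\<close>: the preimage of the normal image of
    \<open>T\<close> contains \<open>K\<close> and \<open>T\<close>; unless \<open>T\<close> lies in
    \<open>K\<close>, maximality of \<open>K\<close> forces this preimage to be
    \<open>S\<close>.\<close>
  have dich: "T \<subseteq> K \<or> ?f ` T = carrier ?G" if T: "T \<subseteq> S" and N: "?f ` T \<lhd> ?G" for T
  proof (cases "T \<subseteq> K")
    case False
    let ?L = "{x \<in> S. ?f x \<in> ?f ` T}"
    interpret N: normal "?f ` T" ?G by (fact N)
    have "x \<in> ?L" if "x \<in> K" for x
    proof -
      have "x \<in> S" using reflexive_unitary_subsemigroupD(2)[OF K] that by blast
      moreover from this have "?f x \<in> ?f ` T" using ker[of x] that N.one_closed by simp
      ultimately show ?thesis by blast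
    qed
    then have "K \<subseteq> ?L" by blast
    moreover have "T \<subseteq> ?L" using T by auto
    ultimately have "K \<subset> ?L" using False by blast
    then have "?L = S"
      using mK f.vimage_normal[OF N] unfolding maximal_rus_def by blast
    then have "?f s \<in> ?f ` T" if "s \<in> S" for s using that by blast
    then have "carrier ?G \<subseteq> ?f ` T" unfolding f.surj[symmetric] by (rule image_subsetI)
    then show ?thesis using N.subset by (intro disjI2 equalityI)
  qed blast
  \<comment> \<open>Otherwise \<open>H \<subset> K\<close>, and maximality of \<open>H\<close> gives
    \<open>K = S\<close>, against \<open>K \<noteq> S\<close>.\<close>
  have "\<not> H \<subseteq> K"
    using mH mK K \<open>H \<noteq> K\<close> unfolding maximal_rus_def by blast
  then have surj: "?f ` H = carrier ?G"
    using dich[OF HS f.image_normal[OF H]] by blast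
  interpret h: semigroup_group_hom ?G H ?f
    by unfold_locales (fact H_ls, fact surj, rule f.hom, use HS in auto)
  have D: "H \<inter> K = {x \<in> H. ?f x = \<one>\<^bsub>?G\<^esub>}"
    using ker HS by auto
  show "factor_semigroup H (H \<inter> K) \<cong> ?G"
    by (rule h.factor_semigroup_kernel_iso[OF D])
  have "T = H" if T: "reflexive_unitary_subsemigroup T H" and DT: "H \<inter> K \<subset> T" for T
  proof -
    have TH: "T \<subseteq> H" by (rule reflexive_unitary_subsemigroupD(2)[OF T])
    have "?f ` T = carrier ?G"
      using dich[OF _ h.image_normal[OF T]] TH HS DT by blast
    then have "x \<in> T" if x: "x \<in> H" for x
    proof -
      obtain t where "t \<in> T" "?f x = ?f t"
        using h.closed[OF x] unfolding \<open>?f ` T = carrier ?G\<close>[symmetric] by (elim imageE)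
      then show ?thesis using h.mem_if_image_eq[OF T _ x] D DT by blast
    qed
    then show ?thesis using TH by blast
  qed
  then show "maximal_rus (H \<inter> K) H"
    using reflexive_unitary_subsemigroup_Int[OF S H K] \<open>\<not> H \<subseteq> K\<close>
    unfolding maximal_rus_def by blast
qed

section \<open>Composition factors as a multiset and their uniqueness\<close>

text \<open>Only the multiset of factors is kept, because isomorphism of series ignores their order.
  The series is built from the bottom up; its last term need not be a single element.\<close>

inductive composition_factors ::
  "'a::semigroup_mult set \<Rightarrow> 'a set monoid multiset \<Rightarrow> bool" where
  base: "(\<And>T. reflexive_unitary_subsemigroup T S \<Longrightarrow> T = S) \<Longrightarrow> composition_factors S {#}"
| step: "maximal_rus T S \<Longrightarrow> composition_factors T M \<Longrightarrow>
    composition_factors S (add_mset (factor_semigroup S T) M)"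

text \<open>The group conditions make the relation symmetric; in return it is reflexive only at
  groups.\<close>

definition group_iso :: "('a, 'c) monoid_scheme \<Rightarrow> ('a, 'c) monoid_scheme \<Rightarrow> bool" where
  "group_iso G H \<longleftrightarrow> group G \<and> group H \<and> G \<cong> H"

lemma group_iso_sym: "group_iso G H \<Longrightarrow> group_iso H G"
  by (simp add: group_iso_def group.iso_sym)

lemma rel_mset_group_iso_trans:
  "rel_mset group_iso A B \<Longrightarrow> rel_mset group_iso B C \<Longrightarrow> rel_mset group_iso A C"
proof -
  have "group_iso OO group_iso \<le> group_iso"
    by (auto simp: group_iso_def intro: iso_trans)
  then have "rel_mset group_iso OO rel_mset group_iso \<le> rel_mset group_iso"
    unfolding multiset.rel_compp[symmetric] by (rule multiset.rel_mono)
  then show "rel_mset group_iso A B \<Longrightarrow> rel_mset group_iso B C \<Longrightarrow> rel_mset group_iso A C"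
    by blast
qed

lemma rel_mset_group_iso_refl:
  "(\<And>G. G \<in># M \<Longrightarrow> group G) \<Longrightarrow> rel_mset group_iso M M"
  by (rule multiset.rel_refl_strong) (simp add: group_iso_def)

lemma rel_mset_group_iso_sym: "rel_mset group_iso A B \<Longrightarrow> rel_mset group_iso B A"
proof -
  assume "rel_mset group_iso A B"
  then have "rel_mset group_iso\<inverse>\<inverse> B A" by (simp add: multiset.rel_flip)
  then show ?thesis by (rule multiset.rel_mono_strong) (simp add: group_iso_sym)
qed

lemma maximal_rus_left_simple:
  "left_simple_semigroup S \<Longrightarrow> maximal_rus T S \<Longrightarrow> left_simple_semigroup T"
  using left_simple_reflexive_unitary_subsemigroup by (auto simp: maximal_rus_def)

lemma maximal_rus_group:
  "left_simple_semigroup S \<Longrightarrow> maximal_rus T S \<Longrightarrow> group (factor_semigroup S T)"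
  using factor_semigroup_group by (auto simp: maximal_rus_def)

text \<open>Supplies reflexivity of \<open>group_iso\<close> at composition factors; left simplicity
  passes down the series.\<close>

lemma composition_factors_group:
  "composition_factors S M \<Longrightarrow> left_simple_semigroup S \<Longrightarrow> G \<in># M \<Longrightarrow> group G"
  by (induction rule: composition_factors.induct)
    (auto intro: maximal_rus_group maximal_rus_left_simple)

text \<open>Any maximal \<open>N\<close> can replace the first step of a given series without
  changing the factors. If that step is \<open>T \<noteq> N\<close>, the induction hypothesis for
  \<open>T\<close> yields a series through \<open>T \<inter> N\<close>, whose lower part is then
  continued upwards through \<open>N\<close>. That \<open>N\<close> has a composition series is thus
  a conclusion.\<close>

lemma composition_factors_exchange:
  assumes "composition_factors S M" "left_simple_semigroup S" "maximal_rus N S"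
  shows "\<exists>M'. composition_factors N M' \<and>
           rel_mset group_iso (add_mset (factor_semigroup S N) M') M"
  using assms
proof (induction arbitrary: N rule: composition_factors.induct)
  case (base S)
  then show ?case by (auto simp: maximal_rus_def)
next
  case (step T S M)
  note S = step.prems(1)
  note T_ls = maximal_rus_left_simple[OF S step.hyps(1)]
  note N_ls = maximal_rus_left_simple[OF S step.prems(2)]
  show ?case
  proof (cases "T = N")
    case True
    have "rel_mset group_iso (add_mset (factor_semigroup S T) M) (add_mset (factor_semigroup S T) M)"
      using composition_factors_group[OF composition_factors.step[OF step.hyps(1,2)] S]
      by (rule rel_mset_group_iso_refl)
    then show ?thesis using True step.hyps(2) by blast
  next
    case False
    note mT = maximal_rus_Int[OF S step.hyps(1) step.prems(2) False]
    have mN: "maximal_rus (T \<inter> N) N" "factor_semigroup N (T \<inter> N) \<cong> factor_semigroup S T"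
      using maximal_rus_Int[OF S step.prems(2) step.hyps(1)] False by (auto simp: Int_commute)
    obtain M' where M': "composition_factors (T \<inter> N) M'"
      and rel: "rel_mset group_iso (add_mset (factor_semigroup T (T \<inter> N)) M') M"
      using step.IH[OF T_ls mT(1)] by blast
    have iso1: "group_iso (factor_semigroup S N) (factor_semigroup T (T \<inter> N))"
      using mT maximal_rus_group[OF T_ls mT(1)] maximal_rus_group[OF S step.prems(2)]
      by (simp add: group_iso_def group.iso_sym)
    have iso2: "group_iso (factor_semigroup N (T \<inter> N)) (factor_semigroup S T)"
      using mN maximal_rus_group[OF N_ls mN(1)] maximal_rus_group[OF S step.hyps(1)]
      by (simp add: group_iso_def)
    have "rel_mset group_iso M' M'"
      using composition_factors_group[OF M' maximal_rus_left_simple[OF T_ls mT(1)]]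
      by (rule rel_mset_group_iso_refl)
    \<comment> \<open>The two routes from \<open>S\<close> down to \<open>T \<inter> N\<close>, via
      \<open>N\<close> and via \<open>T\<close>, have the same factors up to the swap given by
      \<open>iso1\<close> and \<open>iso2\<close>.\<close>
    then have "rel_mset group_iso
        (add_mset (factor_semigroup N (T \<inter> N)) (add_mset (factor_semigroup S N) M'))
        (add_mset (factor_semigroup S T) (add_mset (factor_semigroup T (T \<inter> N)) M'))"
      using iso1 iso2 by (intro rel_mset_Plus)
    moreover have "rel_mset group_iso
        (add_mset (factor_semigroup S T) (add_mset (factor_semigroup T (T \<inter> N)) M'))
        (add_mset (factor_semigroup S T) M)"
    proof (rule rel_mset_Plus[OF _ rel])
      show "group_iso (factor_semigroup S T) (factor_semigroup S T)"
        using maximal_rus_group[OF S step.hyps(1)] by (simp add: group_iso_def)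
    qed
    ultimately have "rel_mset group_iso
        (add_mset (factor_semigroup S N) (add_mset (factor_semigroup N (T \<inter> N)) M'))
        (add_mset (factor_semigroup S T) M)"
      by (subst add_mset_commute) (rule rel_mset_group_iso_trans)
    then show ?thesis
      using composition_factors.step[OF mN(1) M'] by blast
  qed
qed

text \<open>The exchange lemma makes the first series start with the first step \<open>N\<close> of
  the second; the remainders are both series of \<open>N\<close>, to which the induction hypothesis
  applies.\<close>

lemma composition_factors_unique:
  assumes "composition_factors S M" "composition_factors S M'" "left_simple_semigroup S"
  shows "rel_mset group_iso M M'"
  using assms(2,1,3)
proof (induction arbitrary: M rule: composition_factors.induct)
  case (base S)
  \<comment> \<open>With no proper reflexive unitary subsemigroup in \<open>S\<close>, the rule
    \<open>step\<close> cannot have produced \<open>M\<close>.\<close>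
  from base.prems(1) have "M = {#}"
    by cases (use base.hyps in \<open>auto simp: maximal_rus_def\<close>)
  then show ?case by (simp add: rel_mset_Zero)
next
  case (step N S M')
  obtain M2 where M2: "composition_factors N M2"
    and rel: "rel_mset group_iso (add_mset (factor_semigroup S N) M2) M"
    using composition_factors_exchange[OF step.prems step.hyps(1)] by blast
  have "rel_mset group_iso M2 M'"
    using step.IH[OF M2] maximal_rus_left_simple[OF step.prems(2) step.hyps(1)] by blast
  then have "rel_mset group_iso (add_mset (factor_semigroup S N) M2)
      (add_mset (factor_semigroup S N) M')"
    using maximal_rus_group[OF step.prems(2) step.hyps(1)]
    by (intro rel_mset_Plus) (auto simp: group_iso_def intro: iso_refl)
  then show ?case
    using rel rel_mset_group_iso_sym rel_mset_group_iso_trans by blast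
qed

section \<open>Passage between series and multisets of factors\<close>

text \<open>Lists count from 0, so entry \<open>i\<close> is the factor numbered
  \<open>i + 1\<close> in \<open>isomorphic_series\<close>. The order is kept so that a permutation
  of positions can be recovered.\<close>

definition series_factors :: "nat \<Rightarrow> (nat \<Rightarrow> 'a::semigroup_mult set) \<Rightarrow> 'a set monoid list" where
  "series_factors k A = map (\<lambda>i. factor_semigroup (A i) (A (Suc i))) [0..<k]"

lemma composition_seriesD:
  assumes "composition_series S k A"
  shows "A 0 = S" "i < k \<Longrightarrow> maximal_rus (A (Suc i)) (A i)"
    and "reflexive_unitary_subsemigroup T (A k) \<Longrightarrow> T = A k"
proof -
  have A: "normal_series S k A"
    using assms by (simp add: composition_series_def)
  have max: "\<And>i. i \<in> {1..k + 1} \<Longrightarrow> (A(k + 1 := {})) (i - 1) \<noteq> (A(k + 1 := {})) i \<and>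
          \<not> (\<exists>T. reflexive_unitary_subsemigroup T ((A(k + 1 := {})) (i - 1)) \<and>
                 (A(k + 1 := {})) i \<subset> T \<and> T \<subset> (A(k + 1 := {})) (i - 1))"
    by (rule bspec[OF conjunct2[OF assms[unfolded composition_series_def Let_def]]])
  show "A 0 = S" using A by (simp add: normal_series_def)
  show "maximal_rus (A (Suc i)) (A i)" if "i < k"
  proof -
    have "Suc i \<in> {1..k}" using that by simp
    then have "reflexive_unitary_subsemigroup (A (Suc i)) (A i)"
      using A unfolding normal_series_def by (metis diff_Suc_1)
    moreover have "A i \<noteq> A (Suc i) \<and> \<not> (\<exists>T. reflexive_unitary_subsemigroup T (A i) \<and>
        A (Suc i) \<subset> T \<and> T \<subset> A i)"
      using max[of "Suc i"] that by simp
    ultimately show ?thesis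
      using reflexive_unitary_subsemigroupD(2) unfolding maximal_rus_def by blast
  qed
  \<comment> \<open>At index \<open>k + 1\<close> the next term is empty, so a non-empty
    \<open>T\<close> properly contained in \<open>A k\<close> would lie strictly between.\<close>
  show "T = A k" if T: "reflexive_unitary_subsemigroup T (A k)"
    using max[of "k + 1"] T reflexive_unitary_subsemigroupD(1,2)[OF T] by auto
qed

lemma composition_series_factors:
  assumes "composition_series S k A"
  shows "composition_factors S (mset (series_factors k A))"
proof -
  note D = composition_seriesD[OF assms]
  \<comment> \<open>The induction is on the length \<open>j\<close> of the tail starting at
    \<open>A (k - j)\<close>, since \<open>composition_factors\<close> adds terms at the
    top.\<close>
  have "composition_factors (A (k - j))
      (mset (map (\<lambda>i. factor_semigroup (A i) (A (Suc i))) [k - j..<k]))" if "j \<le> k" for j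
    using that
  proof (induction j)
    case 0
    then show ?case using D(3) by (auto intro: composition_factors.base)
  next
    case (Suc j)
    then obtain m where m: "k - j = Suc m" "k - Suc j = m" "m < k"
      by (metis Suc_diff_Suc Suc_le_eq less_le_trans diff_le_self lessI)
    then show ?case
      using Suc composition_factors.step[OF D(2)[of m]] by (simp add: upt_conv_Cons)
  qed
  from this[of k] show ?thesis
    using D(1) by (simp add: series_factors_def)
qed

text \<open>Related multisets have orderings related entry by entry. Fixing the order of the first
  list reorders the second, and this reordering is the required permutation.\<close>

lemma isomorphic_seriesI:
  assumes "rel_mset group_iso (mset (series_factors k A)) (mset (series_factors n B))"
  shows "isomorphic_series k A n B"
proof -
  obtain ys where ys: "mset ys = mset (series_factors n B)"
    and rel: "list_all2 group_iso (series_factors k A) ys"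
    using assms list_all2_reorder_left_invariance unfolding rel_mset_def by metis
  then have nk: "n = k"
    by (metis diff_zero length_map length_upt list_all2_lengthD series_factors_def size_mset)
  obtain p where p: "p permutes {..<k}" and perm: "permute_list p (series_factors n B) = ys"
    using mset_eq_permutation[OF ys] nk by (auto simp: series_factors_def)
  have iso: "factor_semigroup (A i) (A (Suc i)) \<cong> factor_semigroup (B (p i)) (B (Suc (p i)))"
    if "i < k" for i
  proof -
    have "p i < k" using permutes_in_image[OF p] that by auto
    then have "ys ! i = factor_semigroup (B (p i)) (B (Suc (p i)))"
      using that nk permute_list_nth[of p "series_factors n B" i] p perm
      by (auto simp: series_factors_def)
    moreover have "group_iso (series_factors k A ! i) (ys ! i)"
      using list_all2_nthD[OF rel, of i] that by (simp add: series_factors_def)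
    ultimately show ?thesis
      using that by (simp add: group_iso_def series_factors_def)
  qed
  \<comment> \<open>\<open>q\<close> is \<open>p\<close> transported from \<open>{..<k}\<close> to
    \<open>{1..k}\<close>; it is the identity elsewhere, as \<open>permutes\<close> demands.\<close>
  define q where "q i = (if i \<in> {1..k} then Suc (p (i - 1)) else i)" for i
  have bij_p: "bij_betw p {..<k} {..<k}" by (rule permutes_imp_bij[OF p])
  have "bij_betw (\<lambda>i::nat. i - 1) {1..k} {..<k}"
    by (rule bij_betw_byWitness[where f' = Suc]) auto
  moreover have "bij_betw Suc {..<k} {1..k}"
    by (rule bij_betw_byWitness[where f' = "\<lambda>i. i - 1"]) auto
  ultimately have "bij_betw (Suc \<circ> (p \<circ> (\<lambda>i. i - 1))) {1..k} {1..k}"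
    using bij_p bij_betw_trans by blast
  then have "bij_betw q {1..k} {1..k}"
    by (rule bij_betw_cong[THEN iffD1, rotated]) (simp add: q_def)
  then have "q permutes {1..k}"
    by (rule bij_imp_permutes) (auto simp: q_def)
  moreover have "factor_semigroup (A (i - 1)) (A i) \<cong> factor_semigroup (B (q i - 1)) (B (q i))"
    if "i \<in> {1..k}" for i
    using iso[of "i - 1"] that by (auto simp: q_def)
  ultimately show ?thesis
    using nk by (auto simp: isomorphic_series_def)
qed

theorem theorem10:
  fixes S :: "'a::semigroup_mult set"
  assumes "left_simple_semigroup S"
    and "\<exists>k A. composition_series S k A"
  shows "\<forall>k A n B. composition_series S k A \<and> composition_series S n B
           \<longrightarrow> isomorphic_series k A n B"
  by (intro allI impI, elim conjE,
      intro isomorphic_seriesI composition_factors_unique[OF _ _ assms(1)]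
        composition_series_factors)

end
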